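(* For all integers $n\ge 1$ and $0\le i,j\le n$, $$|\{\pi\in\mathfrak{S}_n(321):\ \mathrm{fp}(\pi)=i,\ \mathrm{exc}(\pi)=j\}|=|\{\pi\in\mathfrak{S}_n(132):\ \mathrm{fp}(\pi)=i,\ \mathrm{exc}(\pi)=j\}|.$$ Equivalently, $\sum_{\pi\in\mathfrak{S}_n(321)}x^{\mathrm{fp}(\pi)}q^{\mathrm{exc}(\pi)}=\sum_{\pi\in\mathfrak{S}_n(132)}x^{\mathrm{fp}(\pi)}q^{\mathrm{exc}(\pi)}$.
   Context: $\mathfrak{S}_n$ is the set of permutations $\pi=\pi_1\cdots\pi_n$ of $\{1,\dots,n\}$. A permutation $\pi\in\mathfrak{S}_n$ contains $\sigma\in\mathfrak{S}_m$ if there are indices $i_1<\dots<i_m$ with $\pi_{i_1}\cdots\pi_{i_m}$ in the same relative order as $\sigma_1\cdots\sigma_m$; otherwise $\pi$ is $\sigma$-avoiding, and $\mathfrak{S}_n(\sigma)$ denotes the set of $\sigma$-avoiding permutations in $\mathfrak{S}_n$. An index $i$ is a fixed point of $\pi$ if $\pi_i=i$ and an excedance if $\pi_i>i$; $\mathrm{fp}(\pi)$ and $\mathrm{exc}(\pi)$ denote the numbers of fixed points and excedances. *)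

theory Defs
  imports "HOL-Combinatorics.Permutations" "HOL-Computational_Algebra.Polynomial"
begin

(* A permutation of {1..n} is a function p with "p permutes {1..n}", that is, a bijection
   of {1..n} that is the identity elsewhere; p i is the i-th letter of its one-line notation. *)

definition one_line :: "nat list \<Rightarrow> nat \<Rightarrow> nat" where
  "one_line w i = (if 1 \<le> i \<and> i \<le> length w then w ! (i - 1) else i)"

(* Containment of the pattern s (a permutation of {1..m}) in p (a permutation of {1..n}):
   f a is the index i_a of the informal definition. *)
definition contains_pattern :: "nat \<Rightarrow> (nat \<Rightarrow> nat) \<Rightarrow> nat \<Rightarrow> (nat \<Rightarrow> nat) \<Rightarrow> bool" where
  "contains_pattern n p m s \<longleftrightarrow>
     (\<exists>f. f ` {1..m} \<subseteq> {1..n} \<and> strict_mono_on {1..m} f \<and>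
          (\<forall>a\<in>{1..m}. \<forall>b\<in>{1..m}. p (f a) < p (f b) \<longleftrightarrow> s a < s b))"

definition avoiders :: "nat \<Rightarrow> nat list \<Rightarrow> (nat \<Rightarrow> nat) set" where
  "avoiders n w = {p. p permutes {1..n} \<and> \<not> contains_pattern n p (length w) (one_line w)}"

definition fp :: "nat \<Rightarrow> (nat \<Rightarrow> nat) \<Rightarrow> nat" where
  "fp n p = card {i \<in> {1..n}. p i = i}"

definition exc :: "nat \<Rightarrow> (nat \<Rightarrow> nat) \<Rightarrow> nat" where
  "exc n p = card {i \<in> {1..n}. p i > i}"

(* Polynomials in x with coefficients polynomials in q. *)
definition fp_exc_poly :: "nat \<Rightarrow> nat list \<Rightarrow> int poly poly" where
  "fp_exc_poly n w = (\<Sum>p\<in>avoiders n w. monom (monom 1 (exc n p)) (fp n p))"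

end

(* A 321-avoiding permutation is increasing on its excedances and on their complement, so it
   is determined by the sets I of excedance positions and J of excedance values. These pairs are the
   2-colored Motzkin paths in which one color of level steps is forbidden at height 0; the level
   steps of the other color at height 0 are the fixed points.

   Splitting at the maximum turns 132-avoiding permutations of {1..n} into noncrossing perfect
   matchings of 2n points, in which excedances are the arcs with midpoint left of the center and
   fixed points are the arcs centered exactly. Removing the points from outside to inside,
   alternately from the left and from the right, gives the transfer recursion of the same Motzkin
   paths: each removed point either opens an arc to a point still to be read or closes an arc, and
   the number of continuations depends only on the number of arcs that are currently open. This is
   the bijection of Elizalde and Deutsch on Dyck paths, in terms of generating functions. *)
theory Submission
  imports Defs
begin

section \<open>Weighted noncrossing matchings\<close>

lemma sum_triangle:
  fixes f :: "int \<Rightarrow> int \<Rightarrow> 'a::comm_monoid_add"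
  shows "(\<Sum>i\<in>{a..<b}. \<Sum>j\<in>{i+1..<b}. f i j) = (\<Sum>j\<in>{a..<b}. \<Sum>i\<in>{a..<j}. f i j)"
proof -
  have "(\<Sum>i\<in>{a..<b}. \<Sum>j\<in>{i+1..<b}. f i j) = (\<Sum>i\<in>{a..<b}. \<Sum>j | j \<in> {a..<b} \<and> i < j. f i j)"
    by (intro sum.cong refl) auto
  also have "\<dots> = (\<Sum>j\<in>{a..<b}. \<Sum>i | i \<in> {a..<b} \<and> i < j. f i j)"
    by (rule sum.swap_restrict) auto
  also have "\<dots> = (\<Sum>j\<in>{a..<b}. \<Sum>i\<in>{a..<j}. f i j)"
    by (intro sum.cong refl) auto
  finally show ?thesis .
qed

lemma sum_atLeastLessThan_split_first:
  fixes f :: "int \<Rightarrow> 'a::comm_monoid_add"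
  shows "a < b \<Longrightarrow> sum f {a..<b} = f a + sum f {a+1..<b}"
proof -
  assume "a < b"
  then have "{a..<b} = insert a {a+1..<b}" by auto
  then show ?thesis by simp
qed

lemma sum_atLeastLessThan_split_last:
  fixes f :: "int \<Rightarrow> 'a::comm_monoid_add"
  shows "a < b \<Longrightarrow> sum f {a..<b} = sum f {a..<b-1} + f (b - 1)"
proof -
  assume "a < b"
  then have "{a..<b} = insert (b - 1) {a..<b-1}" by auto
  then show ?thesis by (simp add: add.commute)
qed

context
  fixes x q :: "'a::comm_ring_1"
begin

text \<open>An arc \<open>(i, j)\<close> is weighted by the position of its midpoint \<open>(i + j) / 2\<close> relative to the
  center \<open>-1/2\<close> of the positions \<open>-n, \<dots>, n - 1\<close>. In a perfect noncrossing matching \<open>j - i\<close> is odd,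
  so only odd arguments matter.\<close>

definition weight :: "int \<Rightarrow> 'a" where
  "weight s = (if s < -1 then q else if s = -1 then x else 1)"

text \<open>The weighted sum over the perfect noncrossing matchings (Dyck paths) of the positions
  \<open>a, \<dots>, b - 1\<close>.\<close>

function matchings :: "int \<Rightarrow> int \<Rightarrow> 'a" where
  "matchings a b = (if b \<le> a then (if a = b then 1 else 0)
     else \<Sum>j\<in>{a+1..<b}. weight (a + j) * matchings (a + 1) j * matchings (j + 1) b)"
  by pat_completeness auto
termination by (relation "measure (\<lambda>(a, b). nat (b - a))") auto

declare matchings.simps [simp del]

lemma matchings_refl [simp]: "matchings a a = 1"
  by (simp add: matchings.simps)

lemma matchings_first:
  "a < b \<Longrightarrow> matchings a b =
     (\<Sum>j\<in>{a+1..<b}. weight (a + j) * matchings (a + 1) j * matchings (j + 1) b)"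
  by (subst matchings.simps) simp

text \<open>The mirror image of the defining recursion. Unless the first arc reaches the last
  position, the induction hypothesis finds the arc of the last position in the part right of the
  first arc; exchanging the two sums and folding the sum over the first arc gives the claim.\<close>

lemma matchings_last:
  assumes "a < b"
  shows "matchings a b =
     (\<Sum>i\<in>{a..<b-1}. weight (i + b - 1) * matchings a i * matchings (i + 1) (b - 1))"
  using assms
proof (induction "nat (b - a)" arbitrary: a b rule: less_induct)
  case less
  show ?case
  proof (cases "a + 1 = b")
    case True
    then show ?thesis using less.prems by (simp add: matchings_first)
  next
    case False
    with less.prems have ab: "a + 1 < b" by simp
    let ?w = "\<lambda>i j. weight (a + i) * matchings (a + 1) i *
       (weight (j + b - 1) * matchings (i + 1) j * matchings (j + 1) (b - 1))"
    have "matchings a b = (\<Sum>j\<in>{a+1..<b}. weight (a + j) * matchings (a + 1) j * matchings (j + 1) b)"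
      using less.prems by (rule matchings_first)
    \<comment> \<open>The arc from \<open>a\<close> to \<open>b - 1\<close> is split off, because
      nothing remains to its right. It returns below as the summand \<open>j = a\<close>.\<close>
    also have "\<dots> = (\<Sum>j\<in>{a+1..<b-1}. weight (a + j) * matchings (a + 1) j * matchings (j + 1) b)
        + weight (a + b - 1) * matchings (a + 1) (b - 1)"
      using ab by (subst sum_atLeastLessThan_split_last) (simp_all add: algebra_simps)
    also have "(\<Sum>j\<in>{a+1..<b-1}. weight (a + j) * matchings (a + 1) j * matchings (j + 1) b)
        = (\<Sum>i\<in>{a+1..<b-1}. \<Sum>j\<in>{i+1..<b-1}. ?w i j)"
    proof (rule sum.cong [OF refl])
      fix i assume "i \<in> {a+1..<b-1}"
      then have "matchings (i + 1) b =
          (\<Sum>j\<in>{i+1..<b-1}. weight (j + b - 1) * matchings (i + 1) j * matchings (j + 1) (b - 1))"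
        by (intro less.hyps) auto
      then show "weight (a + i) * matchings (a + 1) i * matchings (i + 1) b = (\<Sum>j\<in>{i+1..<b-1}. ?w i j)"
        by (simp add: sum_distrib_left)
    qed
    also have "\<dots> = (\<Sum>j\<in>{a+1..<b-1}. \<Sum>i\<in>{a+1..<j}. ?w i j)"
      by (rule sum_triangle)
    also have "\<dots> = (\<Sum>j\<in>{a+1..<b-1}. weight (j + b - 1) * matchings a j * matchings (j + 1) (b - 1))"
      by (intro sum.cong refl) (simp add: matchings_first sum_distrib_left sum_distrib_right mult_ac)
    also have "\<dots> + weight (a + b - 1) * matchings (a + 1) (b - 1)
        = (\<Sum>j\<in>{a..<b-1}. weight (j + b - 1) * matchings a j * matchings (j + 1) (b - 1))"
      using ab by (subst (2) sum_atLeastLessThan_split_first) simp_all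
    finally show ?thesis .
  qed
qed

text \<open>Here \<open>h\<close> positions stay unmatched, none of them below an arc. Whether such a position carries
  an up or a down step of a lattice path is irrelevant for the weight, so paths from height \<open>s\<close> to
  height \<open>t\<close> with minimum \<open>0\<close> are counted in dependence on \<open>h = s + t\<close> only.\<close>

fun partial_matchings :: "nat \<Rightarrow> int \<Rightarrow> int \<Rightarrow> 'a" where
  "partial_matchings 0 a b = matchings a b"
| "partial_matchings (Suc h) a b = (\<Sum>j\<in>{a..<b}. matchings a j * partial_matchings h (j + 1) b)"

lemma partial_matchings_refl: "partial_matchings h a a = (if h = 0 then 1 else 0)"
  by (cases h) simp_all

text \<open>The definition peels off the first unmatched position; exchanging the sums over the
  first and the last one allows peeling from the right.\<close>

lemma partial_matchings_Suc_last:
  "partial_matchings (Suc h) a b = (\<Sum>j\<in>{a..<b}. partial_matchings h a j * matchings (j + 1) b)"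
proof (induction h arbitrary: a)
  case (Suc h)
  have "partial_matchings (Suc (Suc h)) a b =
      (\<Sum>i\<in>{a..<b}. \<Sum>j\<in>{i+1..<b}. matchings a i * (partial_matchings h (i + 1) j * matchings (j + 1) b))"
    by (subst partial_matchings.simps, subst Suc.IH) (simp add: sum_distrib_left)
  also have "\<dots> = (\<Sum>j\<in>{a..<b}. \<Sum>i\<in>{a..<j}. matchings a i * (partial_matchings h (i + 1) j * matchings (j + 1) b))"
    by (rule sum_triangle)
  also have "\<dots> = (\<Sum>j\<in>{a..<b}. partial_matchings (Suc h) a j * matchings (j + 1) b)"
    by (simp add: sum_distrib_right mult.assoc)
  finally show ?case .
qed simp

text \<open>Either the first position is unmatched, which is the summand \<open>j = a\<close> of the
  definition, or it opens an arc, which is then extracted from the leftmost block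
  \<open>matchings a j\<close>.\<close>

lemma partial_matchings_first:
  assumes "a < b"
  shows "partial_matchings h a b = (if h = 0 then 0 else partial_matchings (h - 1) (a + 1) b)
     + (\<Sum>j\<in>{a+1..<b}. weight (a + j) * matchings (a + 1) j * partial_matchings h (j + 1) b)"
proof (cases h)
  case 0
  then show ?thesis using assms by (simp add: matchings_first)
next
  case (Suc k)
  let ?w = "\<lambda>i j. weight (a + i) * matchings (a + 1) i * (matchings (i + 1) j * partial_matchings k (j + 1) b)"
  have "partial_matchings h a b = partial_matchings k (a + 1) b
      + (\<Sum>j\<in>{a+1..<b}. matchings a j * partial_matchings k (j + 1) b)"
    using assms by (simp add: Suc sum_atLeastLessThan_split_first)
  also have "(\<Sum>j\<in>{a+1..<b}. matchings a j * partial_matchings k (j + 1) b)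
      = (\<Sum>j\<in>{a+1..<b}. \<Sum>i\<in>{a+1..<j}. ?w i j)"
    by (intro sum.cong refl) (simp add: matchings_first sum_distrib_left sum_distrib_right mult_ac)
  also have "\<dots> = (\<Sum>i\<in>{a+1..<b}. \<Sum>j\<in>{i+1..<b}. ?w i j)"
    by (rule sum_triangle [symmetric])
  also have "\<dots> = (\<Sum>j\<in>{a+1..<b}. weight (a + j) * matchings (a + 1) j * partial_matchings h (j + 1) b)"
    by (simp add: Suc sum_distrib_left)
  finally show ?thesis by (simp add: Suc)
qed

lemma partial_matchings_last:
  assumes "a < b"
  shows "partial_matchings h a b = (if h = 0 then 0 else partial_matchings (h - 1) a (b - 1))
     + (\<Sum>i\<in>{a..<b-1}. weight (i + b - 1) * partial_matchings h a i * matchings (i + 1) (b - 1))"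
proof (cases h)
  case 0
  then show ?thesis using assms by (simp add: matchings_last)
next
  case (Suc k)
  let ?w = "\<lambda>i j. weight (j + b - 1) * (partial_matchings k a i * matchings (i + 1) j) * matchings (j + 1) (b - 1)"
  have "partial_matchings h a b = (\<Sum>i\<in>{a..<b-1}. partial_matchings k a i * matchings (i + 1) b)
      + partial_matchings k a (b - 1)"
    unfolding Suc partial_matchings_Suc_last
    using assms by (subst sum_atLeastLessThan_split_last) simp_all
  also have "(\<Sum>i\<in>{a..<b-1}. partial_matchings k a i * matchings (i + 1) b)
      = (\<Sum>i\<in>{a..<b-1}. \<Sum>j\<in>{i+1..<b-1}. ?w i j)"
    by (intro sum.cong refl) (simp add: matchings_last sum_distrib_left mult_ac)
  also have "\<dots> = (\<Sum>j\<in>{a..<b-1}. \<Sum>i\<in>{a..<j}. ?w i j)"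
    by (rule sum_triangle)
  also have "\<dots> = (\<Sum>j\<in>{a..<b-1}. weight (j + b - 1) * partial_matchings h a j * matchings (j + 1) (b - 1))"
    unfolding Suc partial_matchings_Suc_last by (simp add: sum_distrib_left sum_distrib_right)
  finally show ?thesis by (simp add: Suc)
qed

definition centered :: "nat \<Rightarrow> nat \<Rightarrow> 'a" where
  "centered n h = partial_matchings h (- int n) (int n)"

lemma centered_0: "centered 0 h = (if h = 0 then 1 else 0)"
  by (simp add: centered_def partial_matchings_refl)

text \<open>Every arc from the first of the positions \<open>-n - 1, \<dots>, n\<close> has its midpoint left of the center
  and so weight \<open>q\<close>, except for the arc to the last one. Up to this exception, the first position is
  either an unmatched one or counted as such after removing its arc (at the cost of a factor \<open>q\<close>).
  The same argument applies to the last position, with weight \<open>1\<close> instead of \<open>q\<close>.\<close>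

lemma centered_Suc:
  "centered (Suc n) h = (if h < 2 then 0 else centered n (h - 2))
     + (if h = 0 then x else 1 + q) * centered n h + q * centered n (h + 2)"
proof -
  let ?a = "- int n" and ?b = "int n + 1"
  \<comment> \<open>The position \<open>n\<close> is added first. Its partner \<open>i\<close>
    satisfies \<open>i \<ge> - n\<close>, so \<open>i + n \<ge> 0\<close> and every such arc has
    weight \<open>1\<close>, without exception.\<close>
  have right: "partial_matchings k ?a ?b = (if k = 0 then 0 else centered n (k - 1)) + centered n (Suc k)" for k
  proof -
    have "(\<Sum>i\<in>{?a..<?b-1}. weight (i + ?b - 1) * partial_matchings k ?a i * matchings (i + 1) (?b - 1))
        = (\<Sum>i\<in>{?a..<?b-1}. partial_matchings k ?a i * matchings (i + 1) (?b - 1))"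
      by (intro sum.cong refl) (simp add: weight_def)
    then show ?thesis
      using partial_matchings_last [of ?a ?b k]
      by (simp add: centered_def partial_matchings_Suc_last del: partial_matchings.simps)
  qed
  \<comment> \<open>Now the position \<open>- n - 1\<close> is added. Its arc to
    \<open>j < n\<close> has weight \<open>q\<close>. The arc to \<open>n\<close> has weight
    \<open>x\<close> and covers everything else, which excludes unmatched positions and forces
    \<open>h = 0\<close>.\<close>
  have "(\<Sum>j\<in>{?a..<?b}. weight (?a - 1 + j) * matchings ?a j * partial_matchings h (j + 1) ?b)
      = (\<Sum>j\<in>{?a..<?b-1}. q * matchings ?a j * partial_matchings h (j + 1) ?b)
        + x * centered n 0 * (if h = 0 then 1 else 0)"
    by (subst sum_atLeastLessThan_split_last)
      (auto simp: weight_def centered_def partial_matchings_refl intro!: sum.cong)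
  \<comment> \<open>Writing \<open>x = q + (x - q)\<close> completes the sum, which then folds to
    \<open>partial_matchings (Suc h)\<close>. For \<open>h = 0\<close> the term
    \<open>- q * centered n 0\<close> later cancels against one produced by
    \<open>right\<close>.\<close>
  also have "\<dots> = q * (\<Sum>j\<in>{?a..<?b}. matchings ?a j * partial_matchings h (j + 1) ?b)
      + (x - q) * centered n 0 * (if h = 0 then 1 else 0)"
    by (subst (2) sum_atLeastLessThan_split_last)
      (auto simp: centered_def partial_matchings_refl sum_distrib_left algebra_simps)
  also have "\<dots> = q * partial_matchings (Suc h) ?a ?b + (if h = 0 then (x - q) * centered n 0 else 0)"
    by simp
  finally have "partial_matchings h (?a - 1) ?b = (if h = 0 then 0 else partial_matchings (h - 1) ?a ?b)
      + (q * partial_matchings (Suc h) ?a ?b + (if h = 0 then (x - q) * centered n 0 else 0))"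
    using partial_matchings_first [of "?a - 1" ?b h] by (simp del: partial_matchings.simps)
  moreover have "centered (Suc n) h = partial_matchings h (?a - 1) ?b"
  proof -
    have "- int (Suc n) = ?a - 1" "int (Suc n) = ?b" by simp_all
    then show ?thesis by (simp only: centered_def)
  qed
  ultimately show ?thesis
    unfolding right by (auto simp: algebra_simps numeral_2_eq_2 less_Suc_eq)
qed

end

section \<open>Avoidance of patterns of length three\<close>

lemma avoiders_permutes: "p \<in> avoiders n w \<Longrightarrow> p permutes {1..n}"
  by (simp add: avoiders_def)

lemma finite_avoiders: "finite (avoiders n w)"
  by (rule finite_subset [OF _ finite_permutations [of "{1..n}"]]) (auto simp: avoiders_def)

lemma contains_321_iff:
  "contains_pattern n p (length [3, 2, 1 :: nat]) (one_line [3, 2, 1]) \<longleftrightarrow>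
     (\<exists>i j k. 1 \<le> i \<and> i < j \<and> j < k \<and> k \<le> n \<and> p k < p j \<and> p j < p i)" (is "?L \<longleftrightarrow> ?R")
proof
  have I: "{1..length [3, 2, 1 :: nat]} = {1, 2, 3}" by auto
  {
    assume ?L
    then obtain f where f: "f ` {1, 2, 3 :: nat} \<subseteq> {1..n}" "strict_mono_on {1, 2, 3 :: nat} f"
      "\<forall>a\<in>{1, 2, 3}. \<forall>b\<in>{1, 2, 3}. p (f a) < p (f b) \<longleftrightarrow> one_line [3, 2, 1] a < one_line [3, 2, 1] b"
      unfolding contains_pattern_def I by blast
    have "f 1 < f 2" "f 2 < f 3" using f(2) by (auto simp: strict_mono_on_def)
    then show ?R using f(1,3)
      by (intro exI [of _ "f 1"] exI [of _ "f 2"] exI [of _ "f 3"]) (auto simp: one_line_def)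
  }
  assume ?R
  then obtain i j k where "1 \<le> i" "i < j" "j < k" "k \<le> n" "p k < p j" "p j < p i" by blast
  then show ?L unfolding contains_pattern_def I
    by (intro exI [of _ "\<lambda>a. if a = 1 then i else if a = 2 then j else k"])
      (auto simp: one_line_def strict_mono_on_def)
qed

lemma contains_132_iff:
  "contains_pattern n p (length [1, 3, 2 :: nat]) (one_line [1, 3, 2]) \<longleftrightarrow>
     (\<exists>i j k. 1 \<le> i \<and> i < j \<and> j < k \<and> k \<le> n \<and> p i < p k \<and> p k < p j)" (is "?L \<longleftrightarrow> ?R")
proof
  have I: "{1..length [1, 3, 2 :: nat]} = {1, 2, 3}" by auto
  {
    assume ?L
    then obtain f where f: "f ` {1, 2, 3 :: nat} \<subseteq> {1..n}" "strict_mono_on {1, 2, 3 :: nat} f"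
      "\<forall>a\<in>{1, 2, 3}. \<forall>b\<in>{1, 2, 3}. p (f a) < p (f b) \<longleftrightarrow> one_line [1, 3, 2] a < one_line [1, 3, 2] b"
      unfolding contains_pattern_def I by blast
    have "f 1 < f 2" "f 2 < f 3" using f(2) by (auto simp: strict_mono_on_def)
    then show ?R using f(1,3)
      by (intro exI [of _ "f 1"] exI [of _ "f 2"] exI [of _ "f 3"]) (auto simp: one_line_def)
  }
  assume ?R
  then obtain i j k where "1 \<le> i" "i < j" "j < k" "k \<le> n" "p i < p k" "p k < p j" by blast
  then show ?L unfolding contains_pattern_def I
    by (intro exI [of _ "\<lambda>a. if a = 1 then i else if a = 2 then j else k"])
      (auto simp: one_line_def strict_mono_on_def)
qed

section \<open>132-avoiding permutations\<close>

lemma avoiders_132D: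
  "\<lbrakk>p \<in> avoiders n [1, 3, 2]; 1 \<le> i; i < j; j < k; k \<le> n; p i < p k\<rbrakk> \<Longrightarrow> \<not> p k < p j"
  unfolding avoiders_def mem_Collect_eq contains_132_iff by blast

lemma avoiders_132I:
  assumes "p permutes {1..n}"
    and "\<And>i j k. \<lbrakk>1 \<le> i; i < j; j < k; k \<le> n; p i < p k\<rbrakk> \<Longrightarrow> \<not> p k < p j"
  shows "p \<in> avoiders n [1, 3, 2]"
  using assms unfolding avoiders_def mem_Collect_eq contains_132_iff by blast

section \<open>Splitting a 132-avoiding permutation at its maximum\<close>

lemma permutesI_inj:
  assumes "finite S" "inj_on p S" "\<And>i. i \<in> S \<Longrightarrow> p i \<in> S" "\<And>i. i \<notin> S \<Longrightarrow> p i = i"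
  shows "p permutes S"
proof (rule bij_imp_permutes)
  have "p ` S = S" using assms by (intro endo_inj_surj) auto
  then show "bij_betw p S S" using assms(2) by (simp add: bij_betw_def)
qed (use assms(4) in auto)

text \<open>In a 132-avoider the letters before the maximum exceed those after it; hence the left
  block is raised by \<open>n - k\<close> and the right block keeps its values. The last branch is
  the identity that \<open>permutes\<close> demands outside the range.\<close>

definition glue :: "nat \<Rightarrow> nat \<Rightarrow> (nat \<Rightarrow> nat) \<Rightarrow> (nat \<Rightarrow> nat) \<Rightarrow> nat \<Rightarrow> nat" where
  "glue n k s t i = (if i \<in> {1..k} then s i + (n - k) else if i = Suc k then Suc n
     else if i \<in> {k+2..Suc n} then t (i - Suc k) else i)"

definition left_part :: "nat \<Rightarrow> nat \<Rightarrow> (nat \<Rightarrow> nat) \<Rightarrow> nat \<Rightarrow> nat" where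
  "left_part n k p i = (if i \<in> {1..k} then p i - (n - k) else i)"

definition right_part :: "nat \<Rightarrow> nat \<Rightarrow> (nat \<Rightarrow> nat) \<Rightarrow> nat \<Rightarrow> nat" where
  "right_part n k p i = (if i \<in> {1..n-k} then p (i + Suc k) else i)"

context
  fixes n k s t
  assumes k: "k \<le> n" and s: "s \<in> avoiders k [1, 3, 2]" and t: "t \<in> avoiders (n - k) [1, 3, 2]"
begin

lemma left_factor_range: "i \<in> {1..k} \<Longrightarrow> s i \<in> {1..k}"
  using permutes_in_image [OF avoiders_permutes [OF s]] by blast

lemma right_factor_range: "i \<in> {1..n-k} \<Longrightarrow> t i \<in> {1..n-k}"
  using permutes_in_image [OF avoiders_permutes [OF t]] by blast

lemma glue_simps:
  "i \<in> {1..k} \<Longrightarrow> glue n k s t i = s i + (n - k)"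
  "glue n k s t (Suc k) = Suc n"
  "i \<in> {k+2..Suc n} \<Longrightarrow> glue n k s t i = t (i - Suc k)"
  by (auto simp: glue_def)

lemma glue_range:
  "i \<in> {1..k} \<Longrightarrow> glue n k s t i \<in> {n-k+1..n}"
  "i \<in> {k+2..Suc n} \<Longrightarrow> glue n k s t i \<in> {1..n-k}"
  subgoal using left_factor_range [of i] k by (auto simp: glue_simps)
  subgoal
  proof -
    assume i: "i \<in> {k+2..Suc n}"
    then have "i - Suc k \<in> {1..n-k}" using k by auto
    then show "glue n k s t i \<in> {1..n-k}" unfolding glue_simps(3) [OF i] by (rule right_factor_range)
  qed
  done

lemma block_cases:
  assumes "i \<in> {1..Suc n}"
  obtains "i \<in> {1..k}" | "i = Suc k" | "i \<in> {k+2..Suc n}"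
  using assms by fastforce

lemma glue_permutes: "glue n k s t permutes {1..Suc n}"
proof (rule permutesI_inj)
  have sinj: "inj s" and tinj: "inj t"
    using s t by (auto intro: permutes_inj avoiders_permutes)
  show "inj_on (glue n k s t) {1..Suc n}"
  proof (rule inj_onI)
    fix i j assume i: "i \<in> {1..Suc n}" and j: "j \<in> {1..Suc n}" and eq: "glue n k s t i = glue n k s t j"
    show "i = j"
      by (rule block_cases [OF i]; rule block_cases [OF j])
        (use eq glue_range [of i] glue_range [of j] in
          \<open>auto simp: glue_simps dest!: injD [OF sinj] injD [OF tinj]\<close>)
  qed
  fix i assume i: "i \<in> {1..Suc n}"
  show "glue n k s t i \<in> {1..Suc n}"
    by (rule block_cases [OF i]) (use glue_range [of i] k in \<open>auto simp: glue_simps(2)\<close>)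
qed (use k in \<open>auto simp: glue_def\<close>)

lemma glue_avoids: "glue n k s t \<in> avoiders (Suc n) [1, 3, 2]"
proof (intro avoiders_132I glue_permutes notI)
  fix a b c assume abc: "1 \<le> a" "a < b" "b < c" "c \<le> Suc n" "glue n k s t a < glue n k s t c"
    "glue n k s t c < glue n k s t b"
  have "a \<in> {1..Suc n}" "c \<in> {1..Suc n}" using abc by auto
  \<comment> \<open>A 132 ending in the left block lies in \<open>s\<close>, one starting in the
    right block lies in \<open>t\<close>. It cannot end at the maximum, and it cannot cross to the
    right block, whose letters are smaller.\<close>
  consider "c \<in> {1..k}" | "c = Suc k" | "a \<in> {1..Suc k}" "c \<in> {k+2..Suc n}" | "a \<in> {k+2..Suc n}"
    using abc by fastforce
  then show False
  proof cases
    case 1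
    then have "s a < s c" "s c < s b" using abc by (auto simp: glue_simps(1))
    then show False using avoiders_132D [OF s, of a b c] abc 1 by auto
  next
    case 2
    then have "b \<in> {1..k}" using abc by auto
    then show False using glue_range(1) [of b] abc 2 by (auto simp: glue_simps(2))
  next
    case 3
    then have "n - k < glue n k s t a"
      using glue_range(1) [of a] k by (cases "a = Suc k") (auto simp: glue_simps(2))
    then show False using glue_range(2) [of c] abc 3 by auto
  next
    case 4
    then have "t (a - Suc k) < t (c - Suc k)" "t (c - Suc k) < t (b - Suc k)"
      using abc by (auto simp: glue_simps(3))
    moreover have "1 \<le> a - Suc k" "a - Suc k < b - Suc k" "b - Suc k < c - Suc k" "c - Suc k \<le> n - k"
      using abc 4 by auto
    ultimately show False using avoiders_132D [OF t] by blast
  qed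
qed

lemma left_part_glue: "left_part n k (glue n k s t) = s"
proof
  fix i show "left_part n k (glue n k s t) i = s i"
    using permutes_not_in [OF avoiders_permutes [OF s], of i]
    by (auto simp: left_part_def glue_def)
qed

lemma right_part_glue: "right_part n k (glue n k s t) = t"
proof
  fix i show "right_part n k (glue n k s t) i = t i"
    using permutes_not_in [OF avoiders_permutes [OF t], of i]
    by (auto simp: right_part_def glue_def)
qed

end

context
  fixes n k p
  assumes p: "p \<in> avoiders (Suc n) [1, 3, 2]" and k: "k \<le> n" and top: "p (Suc k) = Suc n"
begin

lemma p_permutes: "p permutes {1..Suc n}"
  using p by (rule avoiders_permutes)

lemmas p_avoids = avoiders_132D [OF p]

lemma p_inj: "inj p"
  using p_permutes by (rule permutes_inj)

lemma p_le: "i \<in> {1..Suc n} \<Longrightarrow> i \<noteq> Suc k \<Longrightarrow> p i \<in> {1..n}"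
  using permutes_in_image [OF p_permutes, of i] injD [OF p_inj, of i "Suc k"] top
  by (auto simp: le_Suc_eq)

text \<open>A larger letter to the right would complete a 132 with the maximum in between.\<close>

lemma left_gt_right:
  assumes "i \<in> {1..k}" "j \<in> {k+2..Suc n}"
  shows "p j < p i"
proof -
  have "p i \<noteq> p j" using injD [OF p_inj, of i j] assms by auto
  moreover have "\<not> p i < p j"
    using p_avoids [of i "Suc k" j] p_le [of j] top assms by auto
  ultimately show ?thesis by simp
qed

text \<open>The \<open>n - k\<close> letters after the maximum are distinct, positive and smaller
  than \<open>p i\<close>.\<close>

lemma left_range: "i \<in> {1..k} \<Longrightarrow> p i \<in> {n-k+1..n}"
proof -
  assume i: "i \<in> {1..k}"
  have "p ` {k+2..Suc n} \<subseteq> {1..<p i}"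
    using left_gt_right [OF i] p_le k by fastforce
  then have "card (p ` {k+2..Suc n}) \<le> card {1..<p i}" by (rule card_mono [rotated]) simp
  moreover have "card (p ` {k+2..Suc n}) = n - k"
    by (subst card_image) (auto intro: inj_on_subset [OF p_inj])
  ultimately show ?thesis using p_le [of i] i k by auto
qed

text \<open>Dually, the \<open>k\<close> letters before the maximum are distinct, at most
  \<open>n\<close> and larger than \<open>p j\<close>.\<close>

lemma right_range: "j \<in> {k+2..Suc n} \<Longrightarrow> p j \<in> {1..n-k}"
proof -
  assume j: "j \<in> {k+2..Suc n}"
  have "p ` {1..k} \<subseteq> {p j<..n}"
    using left_gt_right [OF _ j] left_range by fastforce
  then have "card (p ` {1..k}) \<le> card {p j<..n}" by (rule card_mono [rotated]) simp
  moreover have "card (p ` {1..k}) = k"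
    by (subst card_image) (auto intro: inj_on_subset [OF p_inj])
  ultimately show ?thesis using p_le [of j] j k by auto
qed

lemma left_part_avoids: "left_part n k p \<in> avoiders k [1, 3, 2]"
proof (rule avoiders_132I)
  show "left_part n k p permutes {1..k}"
  proof (rule permutesI_inj)
    show "inj_on (left_part n k p) {1..k}"
    proof (rule inj_onI)
      fix i j assume ij: "i \<in> {1..k}" "j \<in> {1..k}" "left_part n k p i = left_part n k p j"
      then have "p i = p j"
        using left_range [of i] left_range [of j] by (auto simp: left_part_def)
      then show "i = j" by (rule injD [OF p_inj])
    qed
  next
    fix i assume "i \<in> {1..k}"
    then show "left_part n k p i \<in> {1..k}"
      using left_range [of i] k by (auto simp: left_part_def)
  qed (auto simp: left_part_def)
next
  fix a b c assume abc: "1 \<le> a" "a < b" "b < c" "c \<le> k" "left_part n k p a < left_part n k p c"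
  then have "p a < p c" by (auto simp: left_part_def)
  then have "\<not> p c < p b" using p_avoids [of a b c] abc k by simp
  then show "\<not> left_part n k p c < left_part n k p b"
    using abc by (auto simp: left_part_def)
qed

lemma right_part_avoids: "right_part n k p \<in> avoiders (n - k) [1, 3, 2]"
proof (rule avoiders_132I)
  show "right_part n k p permutes {1..n-k}"
  proof (rule permutesI_inj)
    show "inj_on (right_part n k p) {1..n-k}"
      by (rule inj_onI) (auto simp: right_part_def dest!: injD [OF p_inj])
  next
    fix i assume "i \<in> {1..n-k}"
    then show "right_part n k p i \<in> {1..n-k}"
      using right_range [of "i + Suc k"] k by (auto simp: right_part_def)
  qed (auto simp: right_part_def)
next
  fix a b c assume abc: "1 \<le> a" "a < b" "b < c" "c \<le> n - k" "right_part n k p a < right_part n k p c"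
  then show "\<not> right_part n k p c < right_part n k p b"
    using p_avoids [of "a + Suc k" "b + Suc k" "c + Suc k"] k
    by (auto simp: right_part_def)
qed

lemma glue_parts: "glue n k (left_part n k p) (right_part n k p) = p"
proof
  fix i
  consider "i \<in> {1..k}" | "i = Suc k" | "i \<in> {k+2..Suc n}" | "i \<notin> {1..Suc n}" by fastforce
  then show "glue n k (left_part n k p) (right_part n k p) i = p i"
  proof cases
    case 1
    then show ?thesis using left_range [of i] by (auto simp: glue_def left_part_def)
  next
    case 2
    then show ?thesis by (simp add: glue_def top)
  next
    case 3
    then show ?thesis by (auto simp: glue_def right_part_def)
  next
    case 4
    then show ?thesis using permutes_not_in [OF p_permutes 4] k by (auto simp: glue_def)
  qed
qed

end

section \<open>The weighted sum over 132-avoiders as a sum over matchings\<close>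

context
  fixes x q :: "'a::comm_ring_1"
begin

definition letter_weight :: "int \<Rightarrow> 'a" where
  "letter_weight d = (if d > 0 then q else if d = 0 then x else 1)"

text \<open>The shift \<open>r\<close> is needed for the recursion: splitting a 132-avoider at its maximum
  moves both parts off the diagonal.\<close>

definition shifted_weight :: "nat \<Rightarrow> int \<Rightarrow> (nat \<Rightarrow> nat) \<Rightarrow> 'a" where
  "shifted_weight n r p = (\<Prod>i\<in>{1..n}. letter_weight (int (p i) - int i + r))"

definition shifted_sum :: "nat \<Rightarrow> int \<Rightarrow> 'a" where
  "shifted_sum n r = (\<Sum>p\<in>avoiders n [1, 3, 2]. shifted_weight n r p)"

text \<open>The left block gains \<open>n - k\<close> in value, the right block moves by
  \<open>Suc k\<close> positions, and the maximum is displaced by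
  \<open>Suc n - Suc k = n - k\<close>.\<close>

lemma shifted_weight_glue:
  assumes "k \<le> n" "s \<in> avoiders k [1, 3, 2]" "t \<in> avoiders (n - k) [1, 3, 2]"
  shows "shifted_weight (Suc n) r (glue n k s t) =
    shifted_weight k (r + int (n - k)) s * letter_weight (r + int (n - k))
      * shifted_weight (n - k) (r - int (Suc k)) t"
proof -
  let ?f = "\<lambda>i. letter_weight (int (glue n k s t i) - int i + r)"
  have "{1..Suc n} = {1..k} \<union> ({Suc k} \<union> {k+2..Suc n})" using assms(1) by auto
  then have "shifted_weight (Suc n) r (glue n k s t) = prod ?f {1..k} * (?f (Suc k) * prod ?f {k+2..Suc n})"
    unfolding shifted_weight_def by (simp only:) (subst prod.union_disjoint, auto)+
  also have "prod ?f {1..k} = shifted_weight k (r + int (n - k)) s"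
    unfolding shifted_weight_def
    by (intro prod.cong refl) (simp add: glue_simps [OF assms] algebra_simps)
  also have "?f (Suc k) = letter_weight (r + int (n - k))"
    using assms(1) by (simp add: glue_simps [OF assms] of_nat_diff algebra_simps)
  also have "prod ?f {k+2..Suc n} = shifted_weight (n - k) (r - int (Suc k)) t"
    unfolding shifted_weight_def
    by (rule prod.reindex_bij_witness [of _ "\<lambda>i. i + Suc k" "\<lambda>i. i - Suc k"])
      (auto simp: glue_simps [OF assms] of_nat_diff algebra_simps)
  finally show ?thesis by (simp add: mult_ac)
qed

lemma shifted_sum_0: "shifted_sum 0 r = 1"
proof -
  have "id \<in> avoiders 0 [1, 3, 2]" by (rule avoiders_132I) auto
  then have "avoiders 0 [1, 3, 2] = {id}" by (auto dest: avoiders_permutes)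
  then show ?thesis by (simp add: shifted_sum_def shifted_weight_def)
qed

lemma shifted_sum_Suc:
  "shifted_sum (Suc n) r = (\<Sum>k\<le>n. letter_weight (r + int (n - k))
     * shifted_sum k (r + int (n - k)) * shifted_sum (n - k) (r - int (Suc k)))"
proof -
  let ?A = "\<lambda>n. avoiders n [1, 3, 2]"
  let ?h = "\<lambda>(k, s, t). glue n k s t"
  let ?D = "SIGMA k:{..n}. ?A k \<times> ?A (n - k)"
  \<comment> \<open>The number \<open>k\<close> of letters before the maximum is recovered as
    \<open>inv p (Suc n) - 1\<close>.\<close>
  have pos: "inv p (Suc n) - 1 \<le> n" "p (Suc (inv p (Suc n) - 1)) = Suc n" if "p \<in> ?A (Suc n)" for p
  proof -
    have perm: "p permutes {1..Suc n}" using that by (rule avoiders_permutes)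
    then have "inv p (Suc n) \<in> {1..Suc n}"
      using permutes_in_image [OF permutes_inv [OF perm], of "Suc n"] by simp
    moreover have "p (inv p (Suc n)) = Suc n" using permutes_inverses(1) [OF perm] .
    ultimately show "inv p (Suc n) - 1 \<le> n" "p (Suc (inv p (Suc n) - 1)) = Suc n" by auto
  qed
  have "shifted_sum (Suc n) r = (\<Sum>y\<in>?D. shifted_weight (Suc n) r (?h y))"
    unfolding shifted_sum_def
  proof (rule sum.reindex_bij_witness [of _ ?h
        "\<lambda>p. let k = inv p (Suc n) - 1 in (k, left_part n k p, right_part n k p)"])
    fix y assume "y \<in> ?D"
    then obtain k s t where y: "y = (k, s, t)" and kst: "k \<le> n" "s \<in> ?A k" "t \<in> ?A (n - k)" by auto
    have "inv (glue n k s t) (Suc n) = Suc k"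
      using inv_f_eq [OF permutes_inj [OF glue_permutes [OF kst]] glue_simps(2) [OF kst]] .
    then show "(let k = inv (?h y) (Suc n) - 1 in (k, left_part n k (?h y), right_part n k (?h y))) = y"
      by (simp add: y left_part_glue [OF kst] right_part_glue [OF kst])
    show "?h y \<in> ?A (Suc n)" using glue_avoids [OF kst] y by simp
  next
    fix p assume p: "p \<in> ?A (Suc n)"
    let ?k = "inv p (Suc n) - 1"
    let ?y = "let k = inv p (Suc n) - 1 in (k, left_part n k p, right_part n k p)"
    show eq: "?h ?y = p"
      unfolding Let_def prod.case by (rule glue_parts [OF p pos [OF p]])
    show "?y \<in> ?D"
      using pos(1) [OF p] left_part_avoids [OF p pos [OF p]] right_part_avoids [OF p pos [OF p]]
      by (simp add: Let_def del: One_nat_def)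
    show "shifted_weight (Suc n) r (?h ?y) = shifted_weight (Suc n) r p"
      unfolding eq by (rule refl)
  qed
  also have "\<dots> = (\<Sum>k\<le>n. \<Sum>(s, t)\<in>?A k \<times> ?A (n - k). shifted_weight (Suc n) r (glue n k s t))"
    by (subst sum.Sigma) (auto simp: finite_avoiders intro!: sum.cong)
  also have "\<dots> = (\<Sum>k\<le>n. letter_weight (r + int (n - k))
     * shifted_sum k (r + int (n - k)) * shifted_sum (n - k) (r - int (Suc k)))"
  proof (rule sum.cong [OF refl])
    fix k assume k: "k \<in> {..n}"
    have "(\<Sum>(s, t)\<in>?A k \<times> ?A (n - k). shifted_weight (Suc n) r (glue n k s t))
       = (\<Sum>s\<in>?A k. \<Sum>t\<in>?A (n - k). shifted_weight k (r + int (n - k)) s * letter_weight (r + int (n - k))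
            * shifted_weight (n - k) (r - int (Suc k)) t)"
      unfolding sum.cartesian_product [symmetric] using k
      by (intro sum.cong refl) (simp add: shifted_weight_glue)
    also have "\<dots> = letter_weight (r + int (n - k)) * shifted_sum k (r + int (n - k))
        * shifted_sum (n - k) (r - int (Suc k))"
      by (simp add: shifted_sum_def sum_product sum_distrib_left mult_ac)
    finally show "(\<Sum>(s, t)\<in>?A k \<times> ?A (n - k). shifted_weight (Suc n) r (glue n k s t)) = \<dots>" .
  qed
  finally show ?thesis .
qed

text \<open>Removing an arc from an odd number of positions leaves an odd part inside it or to its
  right, so the induction hypothesis kills every summand.\<close>

lemma matchings_odd: "odd (b - a) \<Longrightarrow> matchings x q a b = 0"
proof (induction "nat (b - a)" arbitrary: a b rule: less_induct)
  case less
  show ?case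
  proof (cases "a < b")
    case True
    have "matchings x q (a + 1) j * matchings x q (j + 1) b = 0" if "j \<in> {a+1..<b}" for j
    proof (cases "odd (j - (a + 1))")
      case True
      then have "matchings x q (a + 1) j = 0" using that by (intro less.hyps) auto
      then show ?thesis by simp
    next
      case False
      then have "odd (b - (j + 1))" using less.prems by auto
      then have "matchings x q (j + 1) b = 0" using that by (intro less.hyps) auto
      then show ?thesis by simp
    qed
    then have "weight x q (a + j) * matchings x q (a + 1) j * matchings x q (j + 1) b = 0"
      if "j \<in> {a+1..<b}" for j using that by (simp add: mult.assoc)
    then show ?thesis using True by (simp add: matchings_first)
  next
    case False
    then show ?thesis using less.prems by (auto simp: matchings.simps)
  qed
qed

text \<open>Both sides satisfy the same recursion: the maximum corresponds to the arc of the first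
  position, the left part to the matching inside it and the right part to the matching after
  it.\<close>

lemma shifted_sum_eq_matchings: "shifted_sum n r = matchings x q (- r - int n) (int n - r)"
proof (induction n arbitrary: r rule: less_induct)
  case (less n)
  show ?case
  proof (cases n)
    case 0
    then show ?thesis by (simp add: shifted_sum_0)
  next
    case (Suc m)
    let ?a = "- r - int n" and ?b = "int n - r"
    let ?g = "\<lambda>j. weight x q (?a + j) * matchings x q (?a + 1) j * matchings x q (j + 1) ?b"
    \<comment> \<open>The arc to \<open>?j k\<close> encloses \<open>2 * k\<close> positions,
      corresponding to the \<open>k\<close> letters before the maximum. All other targets enclose an
      odd number of positions and contribute \<open>0\<close>.\<close>
    let ?j = "\<lambda>k. ?a + 1 + 2 * int k"
    have "matchings x q ?a ?b = sum ?g {?a+1..<?b}"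
      using Suc by (intro matchings_first) simp
    also have "\<dots> = sum ?g (?j ` {..m})"
    proof (rule sum.mono_neutral_right)
      show "\<forall>i\<in>{?a+1..<?b} - ?j ` {..m}. ?g i = 0"
      proof
        fix i assume i: "i \<in> {?a+1..<?b} - ?j ` {..m}"
        have "odd (i - (?a + 1))"
        proof
          assume "even (i - (?a + 1))"
          then obtain c where c: "i - (?a + 1) = 2 * c" by (elim evenE)
          then have "i = ?j (nat c)" "nat c \<le> m" using i Suc by auto
          then show False using i by blast
        qed
        then show "?g i = 0" by (simp add: matchings_odd)
      qed
    qed (use Suc in auto)
    also have "\<dots> = (\<Sum>k\<le>m. ?g (?j k))"
      by (subst sum.reindex) (auto simp: inj_on_def)
    also have "\<dots> = (\<Sum>k\<le>m. letter_weight (r + int (m - k))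
        * shifted_sum k (r + int (m - k)) * shifted_sum (m - k) (r - int (Suc k)))"
    proof (rule sum.cong [OF refl])
      fix k assume "k \<in> {..m}"
      then have k: "k \<le> m" by simp
      \<comment> \<open>Here \<open>?a + ?j k = - 1 - 2 * (r + int (m - k))\<close>, so the side of
        the midpoint is the sign of the shifted displacement of the maximum.\<close>
      have "weight x q (?a + ?j k) = letter_weight (r + int (m - k))"
        using k Suc by (auto simp: weight_def letter_weight_def of_nat_diff)
      moreover have "matchings x q (?a + 1) (?j k) = shifted_sum k (r + int (m - k))"
      proof -
        have "?a + 1 = - (r + int (m - k)) - int k" "?j k = int k - (r + int (m - k))"
          using k Suc by (auto simp: of_nat_diff)
        then show ?thesis using less.IH [of k "r + int (m - k)"] k Suc by (simp only: less_Suc_eq_le)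
      qed
      moreover have "matchings x q (?j k + 1) ?b = shifted_sum (m - k) (r - int (Suc k))"
      proof -
        have "?j k + 1 = - (r - int (Suc k)) - int (m - k)" "?b = int (m - k) - (r - int (Suc k))"
          using k Suc by (auto simp: of_nat_diff)
        then show ?thesis using less.IH [of "m - k" "r - int (Suc k)"] k Suc by (simp only:)
      qed
      ultimately show "?g (?j k) = letter_weight (r + int (m - k))
        * shifted_sum k (r + int (m - k)) * shifted_sum (m - k) (r - int (Suc k))" by simp
    qed
    also have "\<dots> = shifted_sum n r" by (simp only: Suc shifted_sum_Suc)
    finally show ?thesis ..
  qed
qed

lemma sum_avoiders_132:
  "(\<Sum>p\<in>avoiders n [1, 3, 2]. q ^ exc n p * x ^ fp n p) = centered x q n 0"
proof -
  have "shifted_weight n 0 p = q ^ exc n p * x ^ fp n p" for p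
  proof -
    have "shifted_weight n 0 p = (\<Prod>i\<in>{1..n}. (if i < p i then q else 1) * (if p i = i then x else 1))"
      unfolding shifted_weight_def by (intro prod.cong refl) (auto simp: letter_weight_def)
    also have "\<dots> = q ^ exc n p * x ^ fp n p"
      by (simp add: prod.distrib exc_def fp_def prod.inter_filter [symmetric])
    finally show ?thesis .
  qed
  then have "(\<Sum>p\<in>avoiders n [1, 3, 2]. q ^ exc n p * x ^ fp n p) = shifted_sum n 0"
    by (simp add: shifted_sum_def)
  then show ?thesis by (simp add: shifted_sum_eq_matchings centered_def)
qed

end

section \<open>321-avoiding permutations\<close>

lemma card_Int_atMost_less:
  fixes T :: "'a::linorder set"
  assumes "finite T" "d \<in> T" "c < d"
  shows "card (T \<inter> {..c}) < card (T \<inter> {..d})"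
proof (rule psubset_card_mono)
  have "d \<in> T \<inter> {..d}" "d \<notin> T \<inter> {..c}" "T \<inter> {..c} \<subseteq> T \<inter> {..d}"
    using assms by auto
  then show "T \<inter> {..c} \<subset> T \<inter> {..d}" by blast
qed (use assms in simp)

lemma card_Int_atMost_inj:
  fixes T :: "'a::linorder set"
  assumes "finite T" "a \<in> T" "b \<in> T" "card (T \<inter> {..a}) = card (T \<inter> {..b})"
  shows "a = b"
  using assms card_Int_atMost_less [of T a b] card_Int_atMost_less [of T b a]
  by (cases a b rule: linorder_cases) simp_all

lemma card_image_Int_atMost:
  fixes f :: "'a::linorder \<Rightarrow> 'b::linorder"
  assumes "strict_mono_on S f" "i \<in> S"
  shows "card (f ` S \<inter> {..f i}) = card (S \<inter> {..i})"
proof -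
  have "f ` S \<inter> {..f i} = f ` (S \<inter> {..i})"
    using assms by (auto simp: strict_mono_on_leD strict_mono_on_less_eq)
  moreover have "inj_on f (S \<inter> {..i})"
    using assms(1) by (meson inj_on_subset inf_le1 strict_mono_on_imp_inj_on)
  ultimately show ?thesis by (simp add: card_image)
qed

text \<open>Increasing maps preserve ranks, so \<open>f i\<close> and \<open>g i\<close> both have
  in the common image the rank of \<open>i\<close> in \<open>S\<close>.\<close>

lemma strict_mono_on_eqI:
  fixes f g :: "'a::linorder \<Rightarrow> 'b::linorder"
  assumes "finite S" "strict_mono_on S f" "strict_mono_on S g" "f ` S = g ` S" "i \<in> S"
  shows "f i = g i"
proof (rule card_Int_atMost_inj)
  show "card (f ` S \<inter> {..f i}) = card (f ` S \<inter> {..g i})"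
    using card_image_Int_atMost [OF assms(2,5)] card_image_Int_atMost [OF assms(3,5)] assms(4) by simp
qed (use assms in auto)

lemma ex_strict_mono_bij_betw:
  fixes S T :: "nat set"
  assumes "finite S" "finite T" "card S = card T"
  obtains f where "bij_betw f S T" "strict_mono_on S f"
proof -
  obtain g where g: "bij_betw g {..<card S} S" "strict_mono_on {..<card S} g"
    by (rule ex_bij_betw_strict_mono_card [OF assms(1)])
  obtain h where h: "bij_betw h {..<card S} T" "strict_mono_on {..<card S} h"
    unfolding assms(3) by (rule ex_bij_betw_strict_mono_card [OF assms(2)])
  let ?k = "inv_into {..<card S} g"
  have k: "bij_betw ?k S {..<card S}" by (rule bij_betw_inv_into [OF g(1)])
  have "strict_mono_on S ?k"
  proof (rule strict_mono_onI)
    fix a b assume "a \<in> S" "b \<in> S" "a < b"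
    moreover have "?k a \<in> {..<card S}" "?k b \<in> {..<card S}"
      using \<open>a \<in> S\<close> \<open>b \<in> S\<close> k by (auto dest: bij_betwE)
    moreover have "g (?k a) = a" "g (?k b) = b"
      using \<open>a \<in> S\<close> \<open>b \<in> S\<close> g(1) by (auto simp: bij_betw_inv_into_right)
    ultimately show "?k a < ?k b" using strict_mono_on_less [OF g(2)] by metis
  qed
  then have "strict_mono_on S (h \<circ> ?k)"
    using h(2) k by (auto simp: strict_mono_on_def dest!: bij_betwE)
  with bij_betw_trans [OF k h(1)] that show thesis by blast
qed

section \<open>Monotonicity of 321-avoiders on excedances and on their complement\<close>

definition excedances :: "nat \<Rightarrow> (nat \<Rightarrow> nat) \<Rightarrow> nat set" where
  "excedances n p = {i \<in> {1..n}. p i > i}"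

context
  fixes n :: nat and p :: "nat \<Rightarrow> nat"
  assumes p: "p \<in> avoiders n [3, 2, 1]"
begin

lemma permutes_321: "p permutes {1..n}"
  using p by (rule avoiders_permutes)

lemma avoids_321: "\<lbrakk>1 \<le> i; i < j; j < k; k \<le> n; p j < p i\<rbrakk> \<Longrightarrow> \<not> p k < p j"
  using p unfolding avoiders_def mem_Collect_eq contains_321_iff by blast

text \<open>A descent \<open>p j < p i\<close> extends to a 321 by some later \<open>k\<close> with
  \<open>p k \<le> j < p j\<close>: otherwise \<open>p\<close> would map \<open>{j+1..n}\<close>
  onto itself, although \<open>p j\<close> also lies there.\<close>

lemma strict_mono_on_excedances: "strict_mono_on (excedances n p) p"
proof (rule strict_mono_onI, rule ccontr)
  fix i j assume ij: "i \<in> excedances n p" "j \<in> excedances n p" "i < j" "\<not> p i < p j"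
  then have "p j < p i"
    using permutes_inj [OF permutes_321] by (metis injD linorder_neqE_nat less_irrefl)
  have "\<exists>k\<in>{j+1..n}. p k \<le> j"
  proof (rule ccontr)
    assume "\<not> ?thesis"
    then have "j + 1 \<le> p k" if "k \<in> {j+1..n}" for k using that by force
    moreover have "p k \<le> n" if "k \<in> {j+1..n}" for k
      using that permutes_in_image [OF permutes_321, of k] by auto
    ultimately have "p ` {j+1..n} \<subseteq> {j+1..n}" by auto
    then have "p ` {j+1..n} = {j+1..n}"
      by (intro endo_inj_surj) (auto intro: inj_on_subset [OF permutes_inj [OF permutes_321]])
    moreover have "p j \<in> {j+1..n}"
      using ij(2) permutes_in_image [OF permutes_321, of j] by (auto simp: excedances_def)
    ultimately have "j \<in> {j+1..n}"
      using inj_image_mem_iff [OF permutes_inj [OF permutes_321]] by metis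
    then show False by simp
  qed
  then obtain k where "j < k" "k \<le> n" "p k \<le> j" by (auto simp: Suc_le_eq)
  then show False using avoids_321 [of i j k] ij \<open>p j < p i\<close> by (auto simp: excedances_def)
qed

text \<open>Here the larger letter is found before \<open>i\<close>: otherwise \<open>p\<close>
  would map \<open>{1..<i}\<close> into \<open>{1..<p i}\<close>, hence onto \<open>{1..<i}\<close>,
  which already contains the value \<open>p j\<close>.\<close>

lemma strict_mono_on_non_excedances: "strict_mono_on ({1..n} - excedances n p) p"
proof (rule strict_mono_onI, rule ccontr)
  fix i j assume ij: "i \<in> {1..n} - excedances n p" "j \<in> {1..n} - excedances n p" "i < j" "\<not> p i < p j"
  then have "p j < p i"
    using permutes_inj [OF permutes_321] by (metis injD linorder_neqE_nat less_irrefl)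
  have "p i \<le> i" using ij(1) by (auto simp: excedances_def)
  have "\<exists>k\<in>{1..<i}. p i < p k"
  proof (rule ccontr)
    assume "\<not> ?thesis"
    then have "p k < p i" if "k \<in> {1..<i}" for k
      using that permutes_inj [OF permutes_321] by (metis injD linorder_neqE_nat atLeastLessThan_iff less_irrefl)
    moreover have "1 \<le> p k" if "k \<in> {1..<i}" for k
      using that ij(1) permutes_in_image [OF permutes_321, of k] by auto
    ultimately have sub: "p ` {1..<i} \<subseteq> {1..<p i}" by auto
    then have eq: "p ` {1..<i} = {1..<i}"
      using \<open>p i \<le> i\<close>
      by (intro endo_inj_surj) (auto intro: inj_on_subset [OF permutes_inj [OF permutes_321]])
    have "p j \<in> {1..<i}"
      using \<open>p j < p i\<close> \<open>p i \<le> i\<close> ij(2) permutes_in_image [OF permutes_321, of j] by auto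
    then have "j \<in> {1..<i}"
      using inj_image_mem_iff [OF permutes_inj [OF permutes_321], of j "{1..<i}"] eq by simp
    then show False using ij(3) by simp
  qed
  then obtain k where "1 \<le> k" "k < i" "p i < p k" by auto
  then show False using avoids_321 [of k i j] ij \<open>p j < p i\<close> by auto
qed

end

text \<open>Read as a lattice path, the letter \<open>m\<close> is an up step if it lies in \<open>I\<close> only, a down step if it lies
  in \<open>J\<close> only, and a level step of one of two colors otherwise. Excluding \<open>m\<close> from \<open>I\<close> in the condition
  forbids the level steps with \<open>m\<close> in both sets at height \<open>0\<close>.\<close>

definition dominates :: "nat \<Rightarrow> nat \<Rightarrow> nat set \<Rightarrow> nat set \<Rightarrow> bool" where
  "dominates n g I J \<longleftrightarrow> card I = card J + g \<and> (\<forall>m\<in>{1..n}. card (J \<inter> {..m}) \<le> card (I \<inter> {..<m}))"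

text \<open>The height of the path after letter \<open>m\<close> is
  \<open>card (I \<inter> {..m}) - card (J \<inter> {..m})\<close>; these are the permitted level
  steps at height \<open>0\<close>.\<close>

definition flats :: "nat \<Rightarrow> nat set \<Rightarrow> nat set \<Rightarrow> nat set" where
  "flats n I J = {m \<in> {1..n}. m \<notin> I \<and> m \<notin> J \<and> card (I \<inter> {..m}) = card (J \<inter> {..m})}"

definition dominating_pairs :: "nat \<Rightarrow> (nat set \<times> nat set) set" where
  "dominating_pairs n = {(I, J) \<in> Pow {1..n} \<times> Pow {1..n}. dominates n 0 I J}"

section \<open>Excedances and fixed points read off from the pair \<open>(I, J)\<close>\<close>

context
  fixes n p I J
  assumes perm: "p permutes {1..n}"
    and I: "I \<subseteq> {1..n}" and J: "p ` I = J"
    and dominates: "dominates n 0 I J"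
    and mono: "strict_mono_on I p" "strict_mono_on ({1..n} - I) p"
begin

lemma card_excedances_rank: "i \<in> I \<Longrightarrow> card (J \<inter> {..p i}) = card (I \<inter> {..i})"
  using card_image_Int_atMost [OF mono(1)] J by simp

lemma image_complement: "p ` ({1..n} - I) = {1..n} - J"
  using permutes_inj [OF perm] permutes_image [OF perm] by (simp add: image_set_diff J)

lemma J_subset: "J \<subseteq> {1..n}"
  using I J permutes_image [OF perm] by blast

lemma card_complement_Int:
  assumes "K \<subseteq> {1..n}" "i \<le> n"
  shows "card (({1..n} - K) \<inter> {..i}) + card (K \<inter> {..i}) = i"
proof -
  have "card (({1..n} - K) \<inter> {..i}) + card (K \<inter> {..i}) = card (({1..n} - K) \<inter> {..i} \<union> K \<inter> {..i})"
    using finite_subset [OF assms(1)] by (intro card_Un_disjoint [symmetric]) auto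
  also have "({1..n} - K) \<inter> {..i} \<union> K \<inter> {..i} = {1..i}"
    using assms by auto
  finally show ?thesis by simp
qed

lemma card_complement_rank:
  "i \<in> {1..n} - I \<Longrightarrow> card (({1..n} - J) \<inter> {..p i}) = card (({1..n} - I) \<inter> {..i})"
  using card_image_Int_atMost [OF mono(2)] image_complement by simp

lemma finite_I: "finite I" and finite_J: "finite J"
  using I J_subset by (auto intro: finite_subset)

text \<open>Positions are compared through ranks. If \<open>p i \<le> i\<close> for some
  \<open>i \<in> I\<close>, then \<open>J\<close> has too few elements up to \<open>i\<close> for
  the rank of \<open>p i\<close> to equal that of \<open>i\<close>. An excedance outside
  \<open>I\<close> would, by ranks in the complements, give \<open>J\<close> more elements up to
  \<open>i\<close> than \<open>I\<close>, against domination.\<close>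

lemma excedances_eq: "excedances n p = I"
proof (intro equalityI subsetI)
  fix i assume i: "i \<in> I"
  then have in1: "i \<in> {1..n}" using I by auto
  have "i < p i"
  proof (rule ccontr)
    assume "\<not> i < p i"
    then have "card (J \<inter> {..p i}) \<le> card (J \<inter> {..i})"
      using finite_J by (intro card_mono) auto
    also have "\<dots> \<le> card (I \<inter> {..<i})" using dominates in1 by (simp add: dominates_def)
    also have "\<dots> < card (I \<inter> {..i})"
      using finite_I i by (intro psubset_card_mono) auto
    finally show False using card_excedances_rank [OF i] by simp
  qed
  then show "i \<in> excedances n p" using in1 by (simp add: excedances_def)
next
  fix i assume i: "i \<in> excedances n p"
  then have in1: "i \<in> {1..n}" "i < p i" by (auto simp: excedances_def)
  show "i \<in> I"
  proof (rule ccontr)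
    assume "i \<notin> I"
    then have "p i \<in> {1..n} - J" using image_complement in1 by blast
    then have "card (({1..n} - J) \<inter> {..i}) < card (({1..n} - J) \<inter> {..p i})"
      using in1 by (intro card_Int_atMost_less) simp_all
    also have "\<dots> = card (({1..n} - I) \<inter> {..i})"
      using card_complement_rank \<open>i \<notin> I\<close> in1 by simp
    finally have "card (I \<inter> {..i}) < card (J \<inter> {..i})"
      using card_complement_Int [of I i] card_complement_Int [of J i] I J_subset in1 by auto
    moreover have "card (J \<inter> {..i}) \<le> card (I \<inter> {..<i})" using dominates in1 by (simp add: dominates_def)
    moreover have "\<dots> \<le> card (I \<inter> {..i})"
      using finite_I by (intro card_mono) auto
    ultimately show False by simp
  qed
qed

text \<open>For \<open>i\<close> outside \<open>I\<close>, the rank of \<open>p i\<close> in the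
  complement of \<open>J\<close> is that of \<open>i\<close> in the complement of \<open>I\<close>.
  If \<open>i\<close> is also outside \<open>J\<close>, then \<open>p i = i\<close> means that
  \<open>I\<close> and \<open>J\<close> have equally many elements up to \<open>i\<close>.\<close>

lemma fixed_points_eq: "{i \<in> {1..n}. p i = i} = flats n I J"
proof (intro equalityI subsetI)
  fix i assume i: "i \<in> {i \<in> {1..n}. p i = i}"
  then have "i \<notin> I" using excedances_eq by (auto simp: excedances_def)
  with i have "i \<in> {1..n} - J" using image_complement by force
  moreover have "card (({1..n} - J) \<inter> {..i}) = card (({1..n} - I) \<inter> {..i})"
    using card_complement_rank [of i] i \<open>i \<notin> I\<close> by auto
  ultimately show "i \<in> flats n I J"
    using card_complement_Int [of I i] card_complement_Int [of J i] I J_subset \<open>i \<notin> I\<close>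
    by (auto simp: flats_def)
next
  fix i assume i: "i \<in> flats n I J"
  then have *: "i \<in> {1..n} - I" "i \<in> {1..n} - J" "card (I \<inter> {..i}) = card (J \<inter> {..i})"
    by (auto simp: flats_def)
  then have "card (({1..n} - J) \<inter> {..p i}) = card (({1..n} - J) \<inter> {..i})"
    using card_complement_rank [OF *(1)] card_complement_Int [of I i] card_complement_Int [of J i] I J_subset by auto
  moreover have "p i \<in> {1..n} - J" using * image_complement by blast
  ultimately have "p i = i" using * card_Int_atMost_inj [of "{1..n} - J" "p i" i] by simp
  then show "i \<in> {i \<in> {1..n}. p i = i}" using * by simp
qed

end

text \<open>An excedance value at most \<open>m\<close> comes from a position strictly below
  \<open>m\<close>.\<close>

lemma dominates_excedances:
  assumes "p permutes {1..n}"
  shows "dominates n 0 (excedances n p) (p ` excedances n p)"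
proof -
  have inj: "inj_on p A" for A using permutes_inj [OF assms] by (rule inj_on_subset) simp
  have "card (p ` excedances n p \<inter> {..m}) \<le> card (excedances n p \<inter> {..<m})" for m
  proof -
    have "p ` excedances n p \<inter> {..m} \<subseteq> p ` (excedances n p \<inter> {..<m})"
      by (auto simp: excedances_def)
    then have "card (p ` excedances n p \<inter> {..m}) \<le> card (p ` (excedances n p \<inter> {..<m}))"
      by (intro card_mono) (auto simp: excedances_def)
    also have "\<dots> = card (excedances n p \<inter> {..<m})" by (rule card_image [OF inj])
    finally show ?thesis .
  qed
  then show ?thesis by (simp add: dominates_def card_image [OF inj])
qed

text \<open>Injectivity: an increasing map is determined by its domain and image. Surjectivity: the
  increasing bijections from \<open>I\<close> to \<open>J\<close> and between the complements are
  pasted together.\<close>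

lemma bij_betw_avoiders_321:
  "bij_betw (\<lambda>p. (excedances n p, p ` excedances n p)) (avoiders n [3, 2, 1]) (dominating_pairs n)"
  (is "bij_betw ?h _ _")
proof (intro bij_betw_imageI inj_onI equalityI subsetI)
  fix p p' assume p: "p \<in> avoiders n [3, 2, 1]" and p': "p' \<in> avoiders n [3, 2, 1]"
    and eq: "?h p = ?h p'"
  note perm = permutes_321 [OF p] permutes_321 [OF p']
  let ?E = "excedances n p"
  have E: "excedances n p' = ?E" "p' ` ?E = p ` ?E" "?E \<subseteq> {1..n}"
    using eq by (auto simp: excedances_def)
  have "p i = p' i" for i
  proof -
    consider "i \<in> ?E" | "i \<in> {1..n} - ?E" | "i \<notin> {1..n}" by blast
    then show ?thesis
    proof cases
      case 1
      then show ?thesis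
        using strict_mono_on_excedances [OF p] strict_mono_on_excedances [OF p'] E
        strict_mono_on_eqI [of ?E p p' i] finite_subset [of ?E "{1..n}"] 1 by simp
    next
      case 2
      have "p ` ({1..n} - ?E) = p' ` ({1..n} - ?E)"
        using permutes_inj [OF perm(1)] permutes_inj [OF perm(2)] E(2)
          permutes_image [OF perm(1)] permutes_image [OF perm(2)]
        by (simp add: image_set_diff)
      then show ?thesis
        using 2 strict_mono_on_non_excedances [OF p] strict_mono_on_non_excedances [OF p'] E
        strict_mono_on_eqI [of "{1..n} - ?E" p p' i] by simp
    next
      case 3
      then show ?thesis using permutes_not_in [OF perm(1)] permutes_not_in [OF perm(2)] by simp
    qed
  qed
  then show "p = p'" by blast
next
  fix y assume "y \<in> ?h ` avoiders n [3, 2, 1]"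
  then obtain p where p: "p \<in> avoiders n [3, 2, 1]" "y = ?h p" by blast
  have sub: "excedances n p \<subseteq> {1..n}" by (auto simp: excedances_def)
  then have "p ` excedances n p \<subseteq> {1..n}"
    using permutes_image [OF permutes_321 [OF p(1)]] by blast
  then show "y \<in> dominating_pairs n"
    using sub dominates_excedances [OF permutes_321 [OF p(1)]] p(2) by (simp add: dominating_pairs_def)
next
  fix y assume "y \<in> dominating_pairs n"
  then obtain I J where y: "y = (I, J)" and I: "I \<subseteq> {1..n}" and J: "J \<subseteq> {1..n}" and v: "dominates n 0 I J"
    by (auto simp: dominating_pairs_def)
  have fin: "finite I" "finite J" using I J by (auto intro: finite_subset)
  obtain f where f: "bij_betw f I J" "strict_mono_on I f"
    using ex_strict_mono_bij_betw [OF fin] v by (auto simp: dominates_def)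
  obtain g where g: "bij_betw g ({1..n} - I) ({1..n} - J)" "strict_mono_on ({1..n} - I) g"
    using ex_strict_mono_bij_betw [of "{1..n} - I" "{1..n} - J"] v I J fin
    by (auto simp: dominates_def card_Diff_subset)
  define p where "p = (\<lambda>i. if i \<in> I then f i else if i \<in> {1..n} then g i else i)"
  have bf: "bij_betw p I J" using f(1) by (rule bij_betw_cong [THEN iffD1, rotated]) (simp add: p_def)
  have bg: "bij_betw p ({1..n} - I) ({1..n} - J)"
    using g(1) by (rule bij_betw_cong [THEN iffD1, rotated]) (simp add: p_def)
  have "bij_betw p (I \<union> ({1..n} - I)) (J \<union> ({1..n} - J))"
    using bf bg by (rule bij_betw_combine) blast
  moreover have "I \<union> ({1..n} - I) = {1..n}" "J \<union> ({1..n} - J) = {1..n}" using I J by auto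
  ultimately have perm: "p permutes {1..n}"
    using I by (intro bij_imp_permutes) (auto simp: p_def)
  have mf: "strict_mono_on I p" using f(2) by (simp add: strict_mono_on_def p_def)
  have mg: "strict_mono_on ({1..n} - I) p" using g(2) by (simp add: strict_mono_on_def p_def)
  have J': "p ` I = J" using bf by (simp add: bij_betw_def)
  have "\<not> contains_pattern n p (length [3, 2, 1 :: nat]) (one_line [3, 2, 1])"
    unfolding contains_321_iff
  proof clarify
    fix i j k assume *: "1 \<le> i" "i < j" "j < k" "k \<le> n" "p k < p j" "p j < p i"
    \<comment> \<open>Two of any three positions agree on membership in \<open>I\<close>, and
      \<open>p\<close> increases along these two, which rules out 321.\<close>
    have no: False if "a \<in> {1..n}" "b \<in> {1..n}" "a \<in> I \<longleftrightarrow> b \<in> I" "a < b" "p b < p a" for a b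
      using strict_mono_onD [OF mf, of a b] strict_mono_onD [OF mg, of a b] that by auto
    show False
      using no [of i j] no [of j k] no [of i k] * by auto
  qed
  then have "p \<in> avoiders n [3, 2, 1]" using perm by (simp add: avoiders_def)
  moreover have "?h p = y" using excedances_eq [OF perm I J' v mf mg] J' y by simp
  ultimately show "y \<in> ?h ` avoiders n [3, 2, 1]" by blast
qed

lemma fp_avoiders_321:
  assumes "p \<in> avoiders n [3, 2, 1]"
  shows "fp n p = card (flats n (excedances n p) (p ` excedances n p))"
proof -
  have "excedances n p \<subseteq> {1..n}" by (auto simp: excedances_def)
  from fixed_points_eq [OF permutes_321 [OF assms] this refl dominates_excedances [OF permutes_321 [OF assms]]
      strict_mono_on_excedances [OF assms] strict_mono_on_non_excedances [OF assms]]
  show ?thesis by (simp only: fp_def)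
qed

section \<open>Recursion for the pairs by the membership of the last letter\<close>

lemma Suc_Int:
  assumes "K \<subseteq> {1..n}" "K' = K \<or> K' = insert (Suc n) K"
  shows "m \<le> n \<Longrightarrow> K' \<inter> {..m} = K \<inter> {..m}" "m \<le> n \<Longrightarrow> K' \<inter> {..<m} = K \<inter> {..<m}"
    "K' \<inter> {..Suc n} = K'" "K' \<inter> {..<Suc n} = K"
  using assms by auto

text \<open>The new condition at \<open>Suc n\<close> involves \<open>card I\<close> and not
  \<open>card I'\<close>, since the letter itself is excluded on that side.\<close>

lemma dominates_Suc:
  assumes I: "I \<subseteq> {1..n}" and J: "J \<subseteq> {1..n}"
    and I': "I' = I \<or> I' = insert (Suc n) I" and J': "J' = J \<or> J' = insert (Suc n) J"
  shows "dominates (Suc n) g I' J' \<longleftrightarrow> card I' = card J' + g \<and> card J' \<le> card I \<and>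
     (\<forall>m\<in>{1..n}. card (J \<inter> {..m}) \<le> card (I \<inter> {..<m}))"
proof -
  have "(\<forall>m\<in>{1..Suc n}. P m) \<longleftrightarrow> P (Suc n) \<and> (\<forall>m\<in>{1..n}. P m)" for P
    by (simp add: atLeastAtMostSuc_conv)
  then show ?thesis
    by (simp add: dominates_def Suc_Int [OF I I'] Suc_Int [OF J J'] del: One_nat_def)
qed

lemma flats_Suc:
  assumes I: "I \<subseteq> {1..n}" and J: "J \<subseteq> {1..n}"
    and I': "I' = I \<or> I' = insert (Suc n) I" and J': "J' = J \<or> J' = insert (Suc n) J"
  shows "flats (Suc n) I' J' = (if Suc n \<notin> I' \<and> Suc n \<notin> J' \<and> card I' = card J'
     then insert (Suc n) (flats n I J) else flats n I J)"
proof -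
  have "m \<in> flats (Suc n) I' J' \<longleftrightarrow>
      m \<in> flats n I J \<or> m = Suc n \<and> Suc n \<notin> I' \<and> Suc n \<notin> J' \<and> card I' = card J'" for m
  proof (cases "m = Suc n")
    case True
    then show ?thesis by (simp add: flats_def Suc_Int [OF I I'] Suc_Int [OF J J'])
  next
    case False
    then have "m \<in> I' \<longleftrightarrow> m \<in> I" "m \<in> J' \<longleftrightarrow> m \<in> J" using I' J' by auto
    with False show ?thesis
      by (auto simp: flats_def le_Suc_eq Suc_Int [OF I I'] Suc_Int [OF J J'])
  qed
  then show ?thesis by auto
qed

context
  fixes x q :: "'a::comm_ring_1"
begin

text \<open>The final height \<open>g\<close> is a parameter because deleting the last step of a
  closed path need not leave a closed one.\<close>

definition pair_weight :: "nat \<Rightarrow> nat \<Rightarrow> nat set \<Rightarrow> nat set \<Rightarrow> 'a" where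
  "pair_weight n g I J = (if dominates n g I J then q ^ card I * x ^ card (flats n I J) else 0)"

definition pair_sum :: "nat \<Rightarrow> nat \<Rightarrow> 'a" where
  "pair_sum n g = (\<Sum>I\<in>Pow {1..n}. \<Sum>J\<in>Pow {1..n}. pair_weight n g I J)"

lemma sum_avoiders_321:
  "(\<Sum>p\<in>avoiders n [3, 2, 1]. q ^ exc n p * x ^ fp n p) = pair_sum n 0"
proof -
  have "(\<Sum>p\<in>avoiders n [3, 2, 1]. q ^ exc n p * x ^ fp n p) =
      (\<Sum>p\<in>avoiders n [3, 2, 1]. case (excedances n p, p ` excedances n p) of (I, J) \<Rightarrow> pair_weight n 0 I J)"
  proof (rule sum.cong [OF refl])
    fix p assume p: "p \<in> avoiders n [3, 2, 1]"
    then show "q ^ exc n p * x ^ fp n p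
        = (case (excedances n p, p ` excedances n p) of (I, J) \<Rightarrow> pair_weight n 0 I J)"
      using dominates_excedances [OF permutes_321 [OF p]] fp_avoiders_321 [OF p]
      by (simp add: pair_weight_def exc_def excedances_def)
  qed
  also have "\<dots> = (\<Sum>(I, J)\<in>dominating_pairs n. pair_weight n 0 I J)"
    by (rule sum.reindex_bij_betw [OF bij_betw_avoiders_321])
  also have "\<dots> = (\<Sum>(I, J)\<in>Pow {1..n} \<times> Pow {1..n}. pair_weight n 0 I J)"
    by (rule sum.mono_neutral_left) (auto simp: dominating_pairs_def pair_weight_def split: if_splits)
  also have "\<dots> = pair_sum n 0"
    by (simp add: pair_sum_def sum.cartesian_product)
  finally show ?thesis .
qed

lemma sum_Pow_Suc:
  fixes f :: "nat set \<Rightarrow> 'a"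
  shows "(\<Sum>I\<in>Pow {1..Suc n}. f I) = (\<Sum>I\<in>Pow {1..n}. f I + f (insert (Suc n) I))"
proof -
  have "inj_on (insert (Suc n)) (Pow {1..n})"
    by (rule inj_onI) (metis PowD Suc_n_not_le_n atLeastAtMost_iff insert_ident subsetD)
  moreover have "Pow {1..Suc n} = Pow {1..n} \<union> insert (Suc n) ` Pow {1..n}"
    by (simp add: atLeastAtMostSuc_conv Pow_insert)
  ultimately show ?thesis
    by (simp add: sum.union_disjoint [of "Pow {1..n}"] sum.reindex sum.distrib)
       (subst sum.union_disjoint, auto simp: sum.reindex)
qed

text \<open>The four cases of the last step: level (marked by \<open>x\<close> at height
  \<open>0\<close>), up, down, and level of the color forbidden at height \<open>0\<close>. A factor
  \<open>q\<close> appears whenever \<open>I\<close> grows.\<close>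

lemma pair_weight_Suc:
  assumes I: "I \<subseteq> {1..n}" and J: "J \<subseteq> {1..n}"
  shows "pair_weight (Suc n) g I J = (if g = 0 then x else 1) * pair_weight n g I J"
    and "pair_weight (Suc n) g (insert (Suc n) I) J = (if g = 0 then 0 else q * pair_weight n (g - 1) I J)"
    and "pair_weight (Suc n) g I (insert (Suc n) J) = pair_weight n (Suc g) I J"
    and "pair_weight (Suc n) g (insert (Suc n) I) (insert (Suc n) J)
           = (if g = 0 then 0 else q * pair_weight n g I J)"
proof -
  have fin: "finite I" "finite J" using I J by (auto intro: finite_subset)
  have new: "Suc n \<notin> I" "Suc n \<notin> J" using I J by auto
  have ins: "card (insert (Suc n) I) = Suc (card I)" "card (insert (Suc n) J) = Suc (card J)"
    using fin new by simp_all
  have flat: "card (flats (Suc n) I J) = (if card I = card J then Suc else id) (card (flats n I J))"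
    "flats (Suc n) (insert (Suc n) I) J = flats n I J"
    "flats (Suc n) I (insert (Suc n) J) = flats n I J"
    "flats (Suc n) (insert (Suc n) I) (insert (Suc n) J) = flats n I J"
  proof -
    have "finite (flats n I J)" "Suc n \<notin> flats n I J" by (auto simp: flats_def)
    then show "card (flats (Suc n) I J) = (if card I = card J then Suc else id) (card (flats n I J))"
      using flats_Suc [OF I J, of I J] new by simp
  qed (use flats_Suc [OF I J] in simp_all)
  note simps = pair_weight_def flat ins dominates_def [of n]
    dominates_Suc [OF I J disjI1 [OF refl] disjI1 [OF refl]] dominates_Suc [OF I J disjI1 [OF refl] disjI2 [OF refl]]
    dominates_Suc [OF I J disjI2 [OF refl] disjI1 [OF refl]] dominates_Suc [OF I J disjI2 [OF refl] disjI2 [OF refl]]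
  let ?B = "\<forall>m\<in>{1..n}. card (J \<inter> {..m}) \<le> card (I \<inter> {..<m})"
  show "pair_weight (Suc n) g I J = (if g = 0 then x else 1) * pair_weight n g I J"
    by (cases ?B; cases g; cases "card I = card J + g") (simp_all only: simps, simp_all)
  show "pair_weight (Suc n) g (insert (Suc n) I) J = (if g = 0 then 0 else q * pair_weight n (g - 1) I J)"
    by (cases ?B; cases g; cases "Suc (card I) = card J + g") (simp_all only: simps, simp_all)
  show "pair_weight (Suc n) g I (insert (Suc n) J) = pair_weight n (Suc g) I J"
    by (cases ?B; cases "card I = Suc (card J) + g") (simp_all only: simps, simp_all)
  show "pair_weight (Suc n) g (insert (Suc n) I) (insert (Suc n) J)
           = (if g = 0 then 0 else q * pair_weight n g I J)"
    by (cases ?B; cases g; cases "card I = card J + g") (simp_all only: simps, simp_all)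
qed

lemma pair_sum_0: "pair_sum 0 g = (if g = 0 then 1 else 0)"
  by (simp add: pair_sum_def pair_weight_def dominates_def flats_def)

lemma pair_sum_Suc:
  "pair_sum (Suc n) g = (if g = 0 then 0 else q * pair_sum n (g - 1))
     + (if g = 0 then x else 1 + q) * pair_sum n g + pair_sum n (Suc g)"
proof -
  have "pair_sum (Suc n) g = (\<Sum>I\<in>Pow {1..n}. \<Sum>J\<in>Pow {1..n}.
      (if g = 0 then 0 else q * pair_weight n (g - 1) I J)
      + (if g = 0 then x else 1 + q) * pair_weight n g I J + pair_weight n (Suc g) I J)"
    unfolding pair_sum_def sum_Pow_Suc sum.distrib [symmetric]
    by (intro sum.cong refl) (simp add: pair_weight_Suc algebra_simps)
  then show ?thesis
    by (simp add: pair_sum_def sum.distrib sum_distrib_left)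
qed

end

section \<open>Comparison of the recursions\<close>

text \<open>Both sides count weighted paths between heights \<open>0\<close> and \<open>g\<close>, but in opposite directions,
  which exchanges up and down steps and accounts for the factor \<open>q ^ g\<close>.\<close>

lemma pair_sum_eq_centered: "pair_sum x q n g = q ^ g * centered x q n (2 * g)"
proof (induction n arbitrary: g)
  case 0
  then show ?case by (simp add: pair_sum_0 centered_0)
next
  case (Suc n)
  show ?case
  proof (cases g)
    case 0
    then show ?thesis by (simp add: pair_sum_Suc centered_Suc Suc.IH numeral_2_eq_2)
  next
    case (Suc h)
    then show ?thesis by (simp add: pair_sum_Suc centered_Suc Suc.IH algebra_simps)
  qed
qed

lemma fp_exc_poly_321_eq_132: "fp_exc_poly n [3, 2, 1] = fp_exc_poly n [1, 3, 2]"
proof -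
  \<comment> \<open>The generic ring elements become the two variables: \<open>x\<close> is the
    outer one, \<open>q\<close> the inner one as a constant of the outer ring.\<close>
  let ?x = "monom 1 1 :: int poly poly" and ?q = "monom (monom 1 1) 0 :: int poly poly"
  have "monom (monom 1 a) b = ?q ^ a * ?x ^ b" for a b
    by (simp add: monom_power mult_monom)
  then have eq: "fp_exc_poly n w = (\<Sum>p\<in>avoiders n w. ?q ^ exc n p * ?x ^ fp n p)" for w
    unfolding fp_exc_poly_def by (rule sum.cong [OF refl])
  show ?thesis
    unfolding eq sum_avoiders_321 sum_avoiders_132 pair_sum_eq_centered by simp
qed

text \<open>Each permutation contributes one monomial whose exponents are its statistics; this turns
  the polynomial identity into the equality of cardinalities.\<close>

lemma coeff_fp_exc_poly:
  "coeff (coeff (fp_exc_poly n w) i) j = int (card {p \<in> avoiders n w. fp n p = i \<and> exc n p = j})"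
proof -
  have "coeff (coeff (fp_exc_poly n w) i) j
      = (\<Sum>p\<in>avoiders n w. if fp n p = i \<and> exc n p = j then 1 else 0)"
    unfolding fp_exc_poly_def coeff_sum by (intro sum.cong refl) auto
  also have "\<dots> = int (card {p \<in> avoiders n w. fp n p = i \<and> exc n p = j})"
    by (simp add: finite_avoiders sum.inter_filter [symmetric])
  finally show ?thesis .
qed

theorem theorem1:
  fixes n :: nat
  assumes "n \<ge> 1"
  shows "(\<forall>i j. i \<le> n \<and> j \<le> n \<longrightarrow>
            card {p \<in> avoiders n [3, 2, 1]. fp n p = i \<and> exc n p = j} =
            card {p \<in> avoiders n [1, 3, 2]. fp n p = i \<and> exc n p = j}) \<and>
         fp_exc_poly n [3, 2, 1] = fp_exc_poly n [1, 3, 2]"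
proof (intro conjI allI impI)
  fix i j
  have "int (card {p \<in> avoiders n [3, 2, 1]. fp n p = i \<and> exc n p = j}) =
      int (card {p \<in> avoiders n [1, 3, 2]. fp n p = i \<and> exc n p = j})"
    unfolding coeff_fp_exc_poly [symmetric] fp_exc_poly_321_eq_132 ..
  then show "card {p \<in> avoiders n [3, 2, 1]. fp n p = i \<and> exc n p = j} =
      card {p \<in> avoiders n [1, 3, 2]. fp n p = i \<and> exc n p = j}"
    by (rule of_nat_eq_iff [THEN iffD1])
qed (rule fp_exc_poly_321_eq_132)

end
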